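(* Let $q$ be a prime power and let $\mathcal{H}$ be the Hermitian curve $x^{q+1}=y^q+y$ in the affine plane $(\mathbb{F}_{q^2})^2$. (1) For $q$ odd, the only possible planar intersections of $\mathcal{H}$ and a parabola are $\{0,1,q-1,q,q+1,2q-1,2q\}$. For each possible planar intersection, the exact number of parabolas sharing that value is: - planar intersection $0$: $q^2(q+1)\frac{(q-1)}{2}$ parabolas; - planar intersection $1$: $q^2(q+1)\frac{q(q-3)}{2}$ parabolas; - planar intersection $q-1$: $q^2(q+1)\frac{q(q-1)^2}{2}$ parabolas; - planar intersection $q$: $q^2(q+1)(q^2-q+1)$ parabolas; - planar intersection $q+1$: $q^2(q+1)\frac{q(q-1)(q-3)}{2}$ parabolas; - planar intersection $2q-1$: $q^2(q+1)\frac{q(q-1)}{2}$ parabolas; - planar intersection $2q$: $q^2(q+1)\frac{(q-1)}{2}$ parabolas. (2) For $q$ even, the only possible planar intersections of $\mathcal{H}$ and a parabola are $\{1,q-1,q+1,2q-1\}$. For each possible planar intersection, the exact number of parabolas sharing that value is: - planar intersection $1$: $q^3(q+1)\left(\frac{q}{2}-1\right)$ parabolas; - planar intersection $q-1$: $q^3(q+1)(q-1)\frac{q}{2}$ parabolas; - planar intersection $q+1$: $q^3(q+1)(q-1)\left(\frac{q}{2}-1\right)$ parabolas; - planar intersection $2q-1$: $q^3(q+1)\frac{q}{2}$ parabolas.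
   Context: $\mathbb{F}_{q^2}$ denotes the finite field with $q^2$ elements. A parabola is a curve $y=ax^2+bx+c$ with $a,b,c\in\mathbb{F}_{q^2}$ and $a\neq 0$; distinct triples $(a,b,c)$ are distinct parabolas. The planar intersection of two curves in the affine plane $(\mathbb{F}_{q^2})^2$ is the number of points of $(\mathbb{F}_{q^2})^2$ lying on both curves, disregarding multiplicities. So the planar intersection of $\mathcal{H}$ with a parabola is the number of pairs $(x,y)\in(\mathbb{F}_{q^2})^2$ with $x^{q+1}=y^q+y$ and $y=ax^2+bx+c$.
   Formalization: For q = 2 the listed values coincide (1 = q-1 and q+1 = 2q-1) with contradictory counts (0 and 24 parabolas each); there the counts for coinciding values are added, giving 24 parabolas with planar intersection 1 and 24 with 3. *)

theory Defs
  imports "HOL-Number_Theory.Prime_Powers" "HOL-Library.Cardinality"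
begin

definition hermitian_curve :: "nat \<Rightarrow> ('a::field \<times> 'a) set" where
  "hermitian_curve q = {(x, y). x ^ (q + 1) = y ^ q + y}"

definition parabola :: "'a::field \<Rightarrow> 'a \<Rightarrow> 'a \<Rightarrow> ('a \<times> 'a) set" where
  "parabola a b c = {(x, y). y = a * x ^ 2 + b * x + c}"

definition planar_intersection :: "('a \<times> 'a) set \<Rightarrow> ('a \<times> 'a) set \<Rightarrow> nat" where
  "planar_intersection C D = card (C \<inter> D)"

text \<open>Parabolas are counted by their coefficient triples, so that distinct triples count as
  distinct parabolas. The phantom argument of type \<open>'a itself\<close> selects the field.\<close>

definition num_parabolas :: "'a::field itself \<Rightarrow> nat \<Rightarrow> nat \<Rightarrow> nat" where
  "num_parabolas _ q n = card {(a::'a, b, c). a \<noteq> 0 \<and>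
     planar_intersection (hermitian_curve q) (parabola a b c) = n}"

end

theory Submission
  imports Defs "HOL-Number_Theory.Residues" "HOL-Computational_Algebra.Polynomial"
begin

text \<open>
  Write \<open>\<sigma> x = x ^ q\<close>, with fixed field \<open>F\<close>, norm \<open>nm\<close> and trace \<open>tr\<close>. A point of the parabola with
  abscissa \<open>x\<close> lies on the curve iff \<open>Q a x - tr (b * x) = tr c\<close>, where \<open>Q a x = nm x - tr (a * x\<^sup>2)\<close>
  is a binary quadratic form over \<open>F\<close>. Every nonzero \<open>nm a\<close> is \<open>s * (1 - s)\<close> with either
  \<open>\<sigma> s = s\<close> or \<open>\<sigma> s = 1 - s\<close>, in any characteristic. In the first case \<open>s * Q a x\<close> is the norm of
  \<open>a * x - s * \<sigma> x\<close>; in the second, \<open>- a * Q a x\<close> is the product of \<open>a * x - s * \<sigma> x\<close> and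
  \<open>a * x - (1 - s) * \<sigma> x\<close>, each of which ranges over a line; for \<open>2 * s = 1\<close> it is a square and the form
  is degenerate. This gives the sizes of the level sets of \<open>Q a\<close>, and completing the square reduces
  the general case to \<open>b = 0\<close>, except in the degenerate case when \<open>b\<close> lies off a line; then all level
  sets have \<open>q\<close> points. Exact sizes come from upper bounds by the degree of a polynomial, which are
  all attained because they add up to the size of the domain.
\<close>

section \<open>Counting by fibres\<close>

lemma card_eq_sum_fibres:
  assumes "finite A" "finite B" "f ` A \<subseteq> B"
  shows "card A = (\<Sum>b\<in>B. card {x \<in> A. f x = b})"
  using sum.group[OF assms, of "\<lambda>_. 1::nat"] by simp

text \<open>The fibres partition \<open>A\<close>, so
  \<open>k * m = card A \<le> k * card B \<le> k * m\<close>. Equality throughout forces both upper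
  bounds to be attained.\<close>

lemma card_fibres_eqI:
  assumes "finite A" "finite B" "f ` A \<subseteq> B"
    and fib: "\<And>b. b \<in> B \<Longrightarrow> card {x \<in> A. f x = b} \<le> k"
    and B: "card B \<le> m" and A: "card A = k * m" and "k > 0"
  shows "card B = m" and "\<And>b. b \<in> B \<Longrightarrow> card {x \<in> A. f x = b} = k"
proof -
  have sum: "k * m = (\<Sum>b\<in>B. card {x \<in> A. f x = b})"
    using card_eq_sum_fibres[OF assms(1-3)] A by simp
  also have "\<dots> \<le> (\<Sum>b\<in>B. k)"
    by (rule sum_mono) (rule fib)
  finally have "k * m \<le> k * card B" by (simp add: mult.commute)
  with B \<open>k > 0\<close> show "card B = m" by simp
  then have "(\<Sum>b\<in>B. card {x \<in> A. f x = b}) = (\<Sum>b\<in>B. k)"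
    using sum by (simp add: mult.commute)
  then show "card {x \<in> A. f x = b} = k" if "b \<in> B" for b
    using sum_mono_inv[of "\<lambda>b. card {x \<in> A. f x = b}" B "\<lambda>_. k"] fib that \<open>finite B\<close> by blast
qed

lemma card_eq_mult_card_image:
  assumes "finite A" and "\<And>x. x \<in> A \<Longrightarrow> card {y \<in> A. f y = f x} = k"
  shows "card A = k * card (f ` A)"
proof -
  have "card A = (\<Sum>b\<in>f ` A. card {x \<in> A. f x = b})"
    using assms(1) by (intro card_eq_sum_fibres) auto
  also have "\<dots> = (\<Sum>b\<in>f ` A. k)"
    by (rule sum.cong) (use assms(2) in auto)
  finally show ?thesis by simp
qed

section \<open>The field with q^2 elements and its Frobenius map\<close>

locale quadratic_extension =
  fixes q :: nat and \<sigma> :: "'a::finite_field \<Rightarrow> 'a"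
  assumes primepow_q: "primepow q"
    and card_field: "CARD('a) = q\<^sup>2"
    and frobenius: "\<And>x. \<sigma> x = x ^ q"
begin

definition F :: "'a set" where "F = {x. \<sigma> x = x}"

definition tr :: "'a \<Rightarrow> 'a" where "tr x = \<sigma> x + x"

definition nm :: "'a \<Rightarrow> 'a" where "nm x = x * \<sigma> x"

lemma q_ge_2: "q \<ge> 2"
  using primepow_gt_Suc_0[OF primepow_q] by simp

lemma CHAR_dvd_q: "CHAR('a) dvd q"
proof -
  have "CHAR('a) dvd q\<^sup>2" using CHAR_dvd_CARD[where 'a = 'a] card_field by simp
  then show ?thesis using CHAR_prime[where 'a = 'a] prime_dvd_power by blast
qed

text \<open>The characteristic is a prime dividing the prime power \<open>q\<close>, hence its base.
  This is what makes \<open>x ^ q\<close> additive.\<close>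

lemma q_power_CHAR: "\<exists>k. q = CHAR('a) ^ k"
proof -
  obtain p k where pk: "prime p" "k > 0" "q = p ^ k"
    using primepow_q by (auto simp: primepow_def)
  have "CHAR('a) dvd p"
    using CHAR_dvd_q CHAR_prime[where 'a = 'a] pk(3) prime_dvd_power by blast
  then have "CHAR('a) = p"
    using CHAR_prime[where 'a = 'a] pk(1) primes_dvd_imp_eq by blast
  with pk show ?thesis by blast
qed

lemma two_eq_0_iff: "(2::'a) = 0 \<longleftrightarrow> even q"
proof
  assume "(2::'a) = 0"
  then have "CHAR('a) dvd 2"
    using of_nat_eq_0_iff_char_dvd[where 'a = 'a, of 2] by simp
  then have "CHAR('a) = 2"
    using CHAR_prime[where 'a = 'a] two_is_prime_nat primes_dvd_imp_eq by blast
  then show "even q" using CHAR_dvd_q by simp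
next
  assume "even q"
  obtain k where "q = CHAR('a) ^ k" using q_power_CHAR by blast
  with \<open>even q\<close> have "even CHAR('a)" by simp
  then have "CHAR('a) = 2"
    using CHAR_prime[where 'a = 'a] two_is_prime_nat primes_dvd_imp_eq by metis
  then show "(2::'a) = 0"
    using of_nat_eq_0_iff_char_dvd[where 'a = 'a, of 2] by simp
qed

lemma sigma_add [simp]: "\<sigma> (x + y) = \<sigma> x + \<sigma> y"
proof -
  obtain k where "q = CHAR('a) ^ k" using q_power_CHAR by blast
  then show ?thesis
    using freshmans_dream'[of q k x y] CHAR_prime[where 'a = 'a] by (simp add: frobenius)
qed

lemma sigma_mult [simp]: "\<sigma> (x * y) = \<sigma> x * \<sigma> y"
  by (simp add: frobenius power_mult_distrib)

lemma sigma_power [simp]: "\<sigma> (x ^ n) = \<sigma> x ^ n"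
  by (simp add: frobenius power_commutes flip: power_mult) (simp add: mult.commute)

lemma sigma_0 [simp]: "\<sigma> 0 = 0" and sigma_1 [simp]: "\<sigma> 1 = 1"
  using q_ge_2 by (simp_all add: frobenius)

lemma sigma_minus [simp]: "\<sigma> (- x) = - \<sigma> x"
  using sigma_add[of x "- x"] by (simp add: add_eq_0_iff)

lemma sigma_diff [simp]: "\<sigma> (x - y) = \<sigma> x - \<sigma> y"
  using sigma_add[of x "- y"] by simp

lemma sigma_2 [simp]: "\<sigma> 2 = 2"
  using sigma_add[of 1 1] by simp

lemma sigma_sigma [simp]: "\<sigma> (\<sigma> x) = x"
  using finite_field_power_card_eq_same[of x] card_field
  by (simp add: frobenius power2_eq_square flip: power_mult)

lemma sigma_eq_0_iff [simp]: "\<sigma> x = 0 \<longleftrightarrow> x = 0"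
  using q_ge_2 by (simp add: frobenius)

lemma tr_in_F [simp]: "tr x \<in> F"
  by (simp add: tr_def F_def)

lemma nm_in_F [simp]: "nm x \<in> F"
  by (simp add: nm_def F_def)

lemma nm_eq_0_iff [simp]: "nm x = 0 \<longleftrightarrow> x = 0"
  by (simp add: nm_def)

section \<open>Fibres of trace and norm\<close>

text \<open>The solutions are the roots of \<open>X^q - \<alpha> X - \<beta>\<close>, which has
  degree exactly \<open>q\<close> because \<open>q \<ge> 2\<close>.\<close>

lemma card_sigma_affine_le: "card {x. \<sigma> x = \<alpha> * x + \<beta>} \<le> q"
proof -
  define p where "p = monom (1::'a) q + [:- \<beta>, - \<alpha>:]"
  have "degree [:- \<beta>, - \<alpha>:] < degree (monom (1::'a) q)"
    using q_ge_2 by (simp add: degree_monom_eq)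
  then have deg: "degree p = q"
    unfolding p_def by (simp add: degree_add_eq_left degree_monom_eq)
  then have "p \<noteq> 0" using q_ge_2 by auto
  have "{x. \<sigma> x = \<alpha> * x + \<beta>} = {x. poly p x = 0}"
    by (auto simp: p_def frobenius poly_monom algebra_simps)
  then show ?thesis using card_poly_roots_bound[OF \<open>p \<noteq> 0\<close>] deg by simp
qed

lemma card_nm_le: "card {x. nm x = n} \<le> q + 1"
proof -
  define p where "p = monom (1::'a) (q + 1) + [:- n:]"
  have deg: "degree p = q + 1"
    unfolding p_def by (simp add: degree_add_eq_left degree_monom_eq)
  then have "p \<noteq> 0" by auto
  have "{x. nm x = n} = {x. poly p x = 0}"
    by (auto simp: p_def frobenius nm_def poly_monom algebra_simps)
  then show ?thesis using card_poly_roots_bound[OF \<open>p \<noteq> 0\<close>] deg by simp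
qed

text \<open>Both \<open>F\<close> and the trace fibres are given by equations affine in
  \<open>x\<close> and \<open>\<sigma> x\<close>, so they have at most \<open>q\<close> elements.
  The trace maps \<open>q * q\<close> elements into \<open>F\<close>, so neither bound can be
  strict.\<close>

lemma card_F: "card F = q"
  and card_tr_fibre: "t \<in> F \<Longrightarrow> card {x. tr x = t} = q"
proof -
  have 1: "card F \<le> q"
    using card_sigma_affine_le[of 1 0] by (simp add: F_def)
  have 2: "card {x \<in> UNIV. tr x = t} \<le> q" for t
  proof -
    have "{x. tr x = t} = {x. \<sigma> x = (-1) * x + t}"
      by (auto simp: tr_def algebra_simps)
    then show ?thesis using card_sigma_affine_le[of "-1" t] by simp
  qed
  have "card (UNIV :: 'a set) = q * q" using card_field by (simp add: power2_eq_square)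
  moreover have "range tr \<subseteq> F" "0 < q" using q_ge_2 by auto
  ultimately have *: "card F = q" "\<And>t. t \<in> F \<Longrightarrow> card {x \<in> UNIV. tr x = t} = q"
    using card_fibres_eqI[of UNIV F tr q q] 1 2 by auto
  show "card F = q" by (rule *)
  show "t \<in> F \<Longrightarrow> card {x. tr x = t} = q"
    using *(2)[of t] by simp
qed

lemma zero_in_F [simp]: "0 \<in> F" and one_in_F [simp]: "1 \<in> F"
  by (simp_all add: F_def)

lemma card_nonzero: "card (UNIV - {0::'a}) = (q + 1) * (q - 1)"
proof -
  have "card (UNIV - {0::'a}) = q\<^sup>2 - 1" using card_field by (simp add: card_Diff_subset)
  also have "\<dots> = (q + 1) * (q - 1)" by (simp add: power2_eq_square algebra_simps)
  finally show ?thesis .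
qed

text \<open>There are \<open>(q + 1) * (q - 1)\<close> nonzero elements and \<open>q - 1\<close>
  nonzero values in \<open>F\<close>, so the degree bound \<open>q + 1\<close> on each fibre is
  attained.\<close>

lemma card_nm_fibre:
  assumes "n \<in> F" "n \<noteq> 0"
  shows "card {x. nm x = n} = q + 1"
proof -
  have sub: "{x \<in> UNIV - {0}. nm x = b} \<subseteq> {x. nm x = b}" for b by auto
  have le: "card {x \<in> UNIV - {0}. nm x = b} \<le> q + 1" for b
    using card_mono[OF _ sub] card_nm_le[of b] by (meson finite le_trans)
  have "card {x \<in> UNIV - {0}. nm x = n} = q + 1"
    by (rule card_fibres_eqI(2)[of "UNIV - {0}" "F - {0}" nm _ "q - 1", OF _ _ _ le _ card_nonzero])
      (use assms card_F in \<open>auto simp: card_Diff_subset\<close>)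
  moreover have "{x \<in> UNIV - {0}. nm x = n} = {x. nm x = n}" using assms by auto
  ultimately show ?thesis by simp
qed

lemma card_nm_vimage:
  assumes "S \<subseteq> F - {0}"
  shows "card {a. nm a \<in> S} = (q + 1) * card S"
proof -
  have "card {a. nm a \<in> S} = (\<Sum>n\<in>S. card {a \<in> {a. nm a \<in> S}. nm a = n})"
    by (rule card_eq_sum_fibres) auto
  also have "\<dots> = (\<Sum>n\<in>S. q + 1)"
  proof (rule sum.cong[OF refl])
    fix n assume "n \<in> S"
    then have "{a \<in> {a. nm a \<in> S}. nm a = n} = {a. nm a = n}" by auto
    then show "card {a \<in> {a. nm a \<in> S}. nm a = n} = q + 1"
      using card_nm_fibre[of n] assms \<open>n \<in> S\<close> by auto
  qed
  finally show ?thesis by simp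
qed

section \<open>The quadratic form: elliptic case\<close>

definition Q :: "'a \<Rightarrow> 'a \<Rightarrow> 'a" where "Q a x = nm x - tr (a * x\<^sup>2)"

lemma Q_in_F [simp]: "Q a x \<in> F"
  by (simp add: F_def Q_def nm_def tr_def)

lemma sigma_Q [simp]: "\<sigma> (Q a x) = Q a x" and sigma_tr [simp]: "\<sigma> (tr x) = tr x"
  by (simp_all add: Q_def nm_def tr_def)

lemma Q_alt: "Q a x = x * \<sigma> x - a * x\<^sup>2 - \<sigma> a * (\<sigma> x)\<^sup>2"
  by (simp add: Q_def nm_def tr_def)

text \<open>After expansion the two sides differ only in the coefficient of
  \<open>x * \<sigma> x\<close>, namely by \<open>nm a - s * (1 - s)\<close>. This is the origin of
  the equation imposed on \<open>s\<close>.\<close>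

lemma nm_twist_eq:
  assumes "\<sigma> s = s" "s * (1 - s) = nm a"
  shows "nm (a * x - s * \<sigma> x) = s * Q a x"
proof -
  have "nm (a * x - s * \<sigma> x) - s * Q a x = (nm a - s * (1 - s)) * (x * \<sigma> x)"
    using assms(1) by (simp add: nm_def Q_alt algebra_simps power2_eq_square)
  then show ?thesis using assms(2) by simp
qed

text \<open>The twist \<open>L\<close> is a bijection with \<open>nm (L x) = s * Q a x\<close>, so
  level sets of \<open>Q a\<close> correspond to fibres of the norm.\<close>

lemma card_Q_elliptic:
  assumes "a \<noteq> 0" "s \<in> F" "2 * s \<noteq> 1" "s * (1 - s) = nm a" "t \<in> F"
  shows "card {x. Q a x = t} = (if t = 0 then 1 else q + 1)"
proof -
  define L where "L x = a * x - s * \<sigma> x" for x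
  have s: "\<sigma> s = s" using assms(2) by (simp add: F_def)
  have "s \<noteq> 0" using assms(1,4) by auto
  have nmL: "nm (L x) = s * Q a x" for x
    unfolding L_def by (rule nm_twist_eq[OF s assms(4)])
  have L0: "x = 0" if "L x = 0" for x
  proof (rule ccontr)
    assume "x \<noteq> 0"
    have 1: "a * x = s * \<sigma> x" using that by (simp add: L_def)
    then have "\<sigma> a * \<sigma> x = s * x" using s by (metis sigma_mult sigma_sigma)
    \<comment> \<open>Multiplying the equation by its conjugate gives \<open>nm a = s * s\<close>.
      Compared with \<open>nm a = s * (1 - s)\<close>, this forces \<open>2 * s = 1\<close>.\<close>
    with 1 have "(a * x) * (\<sigma> a * \<sigma> x) = (s * \<sigma> x) * (s * x)" by simp
    then have "(a * \<sigma> a) * (x * \<sigma> x) = (s * s) * (x * \<sigma> x)" by (simp only: mult_ac)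
    then have "a * \<sigma> a = s * s" using \<open>x \<noteq> 0\<close> by simp
    then have "s * (1 - s) = s * s" using assms(4) by (simp add: nm_def)
    then have "1 - s = s" using \<open>s \<noteq> 0\<close> by simp
    then show False using assms(3) by (simp add: algebra_simps mult_2)
  qed
  have inj: "inj L"
  proof (rule injI)
    fix x y assume "L x = L y"
    then have "L (x - y) = 0" by (simp add: L_def algebra_simps)
    then show "x = y" using L0 by force
  qed
  then have surj: "range L = UNIV" by (simp add: finite_UNIV_inj_surj)
  have "{x. Q a x = t} = L -` {y. nm y = s * t}"
    using nmL \<open>s \<noteq> 0\<close> by auto
  then have *: "card {x. Q a x = t} = card {y. nm y = s * t}"
    using card_vimage_inj[OF inj, of "{y. nm y = s * t}"] surj by simp
  show ?thesis
  proof (cases "t = 0")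
    case True
    then show ?thesis using * by simp
  next
    case False
    have "s * t \<in> F" using s assms(5) by (simp add: F_def)
    then show ?thesis using * False \<open>s \<noteq> 0\<close> card_nm_fibre[of "s * t"] by simp
  qed
qed

section \<open>The quadratic form: hyperbolic case\<close>

text \<open>The values of the twist satisfy an equation linear over \<open>F\<close>, which
  describes a line over \<open>F\<close>. The two sides differ by a multiple of
  \<open>nm a - s * (1 - s)\<close>.\<close>

lemma twist_image:
  assumes "\<sigma> s = 1 - s" "s * (1 - s) = nm a"
  shows "a * \<sigma> (a * x - s * \<sigma> x) = - (1 - s) * (a * x - s * \<sigma> x)"
proof -
  have "a * \<sigma> (a * x - s * \<sigma> x) - - (1 - s) * (a * x - s * \<sigma> x) = (nm a - s * (1 - s)) * \<sigma> x"
    by (simp add: nm_def assms(1) algebra_simps del: sigma_diff)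
      (simp add: assms(1) algebra_simps)
  then show ?thesis using assms(2) by simp
qed

text \<open>The line and the fibres of the twist are solution sets of equations
  \<open>\<sigma> x = \<alpha> * x + \<beta>\<close>, hence have at most \<open>q\<close> elements.
  The domain has \<open>q * q\<close> elements, so all these bounds are attained.\<close>

lemma card_twist:
  assumes "a \<noteq> 0" "\<sigma> s = 1 - s" "s * (1 - s) = nm a"
  shows "card {u. a * \<sigma> u = - (1 - s) * u} = q"
    and "a * \<sigma> u = - (1 - s) * u \<Longrightarrow> card {x. a * x - s * \<sigma> x = u} = q"
proof -
  define U where "U = {u. a * \<sigma> u = - (1 - s) * u}"
  have s0: "s \<noteq> 0" using assms(1,3) by auto
  have "U = {u. \<sigma> u = (- (1 - s) / a) * u + 0}"
    unfolding U_def using assms(1) by (auto simp: field_simps)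
  then have 1: "card U \<le> q" using card_sigma_affine_le by metis
  have 2: "card {x \<in> UNIV. a * x - s * \<sigma> x = u} \<le> q" for u
  proof -
    have "{x \<in> UNIV. a * x - s * \<sigma> x = u} = {x. \<sigma> x = (a / s) * x + (- u / s)}"
      using s0 by (auto simp: field_simps)
    then show ?thesis using card_sigma_affine_le by metis
  qed
  have 3: "range (\<lambda>x. a * x - s * \<sigma> x) \<subseteq> U"
    unfolding U_def using twist_image[OF assms(2,3)] by blast
  have "card (UNIV :: 'a set) = q * q" using card_field by (simp add: power2_eq_square)
  note * = card_fibres_eqI[of UNIV U, OF _ _ 3 2 1 this]
  show "card {u. a * \<sigma> u = - (1 - s) * u} = q"
    using *(1) q_ge_2 by (simp add: U_def)
  show "card {x. a * x - s * \<sigma> x = u} = q" if "a * \<sigma> u = - (1 - s) * u"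
    using *(2)[of u] that q_ge_2 by (simp add: U_def)
qed

text \<open>The parameters \<open>s\<close> and \<open>1 - s\<close> have sum \<open>1\<close> and
  product \<open>a * \<sigma> a\<close>, so the product of the two twists has the coefficients of
  \<open>- a * Q a x\<close> as a form in \<open>x\<close> and \<open>\<sigma> x\<close>.\<close>

lemma twist_mult:
  assumes "s * (1 - s) = nm a"
  shows "(a * x - s * \<sigma> x) * (a * x - (1 - s) * \<sigma> x) = - a * Q a x"
proof -
  have "(a * x - s * \<sigma> x) * (a * x - (1 - s) * \<sigma> x) - - a * Q a x
      = (s * (1 - s) - nm a) * (\<sigma> x)\<^sup>2"
    by (simp add: nm_def Q_alt algebra_simps power2_eq_square)
  then show ?thesis using assms by (simp only: diff_self mult_zero_left right_minus_eq)
qed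

text \<open>The zero set consists of the kernels of the two twists, two lines meeting only in
  \<open>0\<close>. A nonzero level set injects into the \<open>q - 1\<close> nonzero points of a
  line, and the remaining \<open>(q - 1) * (q - 1)\<close> points leave no slack over the
  \<open>q - 1\<close> nonzero levels.\<close>

lemma card_Q_hyperbolic:
  assumes "a \<noteq> 0" "\<sigma> s = 1 - s" "2 * s \<noteq> 1" "s * (1 - s) = nm a" "t \<in> F"
  shows "card {x. Q a x = t} = (if t = 0 then 2 * q - 1 else q - 1)"
proof -
  define L where "L s x = a * x - s * \<sigma> x" for s x
  define U where "U = {u. a * \<sigma> u = - (1 - s) * u}"
  have s': "\<sigma> (1 - s) = 1 - (1 - s)" "(1 - s) * (1 - (1 - s)) = nm a"
    using assms(2,4) by (simp_all add: mult.commute)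
  have mult: "L s x * L (1 - s) x = - a * Q a x" for x
    unfolding L_def by (rule twist_mult[OF assms(4)])
  have determined: "x = y" if "L s x = L s y" "L (1 - s) x = L (1 - s) y" for x y
  proof -
    \<comment> \<open>The two twists of one element differ by a multiple \<open>2 * s - 1\<close>,
      up to sign, of its conjugate; as this factor is nonzero, together they determine the
      element.\<close>
    have "(2 * s - 1) * \<sigma> (x - y) = (L s y - L s x) - (L (1 - s) y - L (1 - s) x)"
      by (simp add: L_def algebra_simps)
    then have "(2 * s - 1) * \<sigma> (x - y) = 0" using that by simp
    then have "\<sigma> (x - y) = 0" using assms(3) by auto
    then show ?thesis by (simp del: sigma_diff)
  qed
  have zero: "{x. Q a x = 0} = {x. L s x = 0} \<union> {x. L (1 - s) x = 0}"
  proof -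
    have "Q a x = 0 \<longleftrightarrow> L s x * L (1 - s) x = 0" for x
      by (simp only: mult) (simp add: assms(1))
    then show ?thesis by auto
  qed
  have "{x. L s x = 0} \<inter> {x. L (1 - s) x = 0} = {0}"
  proof -
    have "L r 0 = 0" for r by (simp add: L_def)
    then show ?thesis using determined[of _ 0] by auto
  qed
  moreover have "card {x. L s x = 0} = q" "card {x. L (1 - s) x = 0} = q"
    using card_twist(2)[OF assms(1,2,4), of 0] card_twist(2)[OF assms(1) s', of 0]
    by (simp_all add: L_def)
  ultimately have c0: "card {x. Q a x = 0} = 2 * q - 1"
    unfolding zero using card_Un_Int[of "{x. L s x = 0}" "{x. L (1 - s) x = 0}"] by simp
  have le: "card {x. Q a x = b} \<le> q - 1" if "b \<noteq> 0" for b
  proof -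
    \<comment> \<open>On a nonzero level the product of the two twists is a fixed nonzero value, so
      the first twist determines the second and hence the point.\<close>
    have "inj_on (L s) {x. Q a x = b}"
    proof (rule inj_onI)
      fix x y assume *: "x \<in> {x. Q a x = b}" "y \<in> {x. Q a x = b}" "L s x = L s y"
      then have "L s x * L (1 - s) x = - a * b" "L s x * L (1 - s) y = - a * b"
        using mult[of x] mult[of y] by simp_all
      moreover have "- a * b \<noteq> 0" using that assms(1) by simp
      ultimately have "L (1 - s) x = L (1 - s) y"
        by (metis mult_left_cancel mult_zero_left)
      then show "x = y" by (rule determined[OF *(3)])
    qed
    moreover have "L s ` {x. Q a x = b} \<subseteq> U - {0}"
    proof (rule image_subsetI)
      fix x assume "x \<in> {x. Q a x = b}"
      then have "L s x * L (1 - s) x \<noteq> 0" using that assms(1) by (simp only: mult) simp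
      then have "L s x \<noteq> 0" by auto
      moreover have "a * \<sigma> (L s x) = - (1 - s) * L s x"
        unfolding L_def by (rule twist_image[OF assms(2,4)])
      ultimately show "L s x \<in> U - {0}" by (simp add: U_def)
    qed
    ultimately have "card {x. Q a x = b} \<le> card (U - {0})"
      by (meson card_inj_on_le finite)
    also have "\<dots> = q - 1"
      using card_twist(1)[OF assms(1,2,4)] by (simp add: U_def card_Diff_subset)
    finally show ?thesis .
  qed
  show ?thesis
  proof (cases "t = 0")
    case False
    have "card (UNIV - {x. Q a x = 0}) = q\<^sup>2 - (2 * q - 1)"
      using c0 card_field by (simp add: card_Diff_subset)
    also have "\<dots> = (q - 1) * (q - 1)"
      using q_ge_2 by (cases q) (auto simp: power2_eq_square algebra_simps)
    finally have cA: "card (UNIV - {x. Q a x = 0}) = (q - 1) * (q - 1)" .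
    have eq: "{x \<in> UNIV - {x. Q a x = 0}. Q a x = b} = {x. Q a x = b}" if "b \<noteq> 0" for b
      using that by auto
    have "Q a ` (UNIV - {x. Q a x = 0}) \<subseteq> F - {0}" "card (F - {0}) \<le> q - 1"
      using card_F by (auto simp: card_Diff_subset)
    moreover have "card {x \<in> UNIV - {x. Q a x = 0}. Q a x = b} \<le> q - 1" if "b \<in> F - {0}" for b
      using that le[of b] eq[of b] by auto
    ultimately have "card {x \<in> UNIV - {x. Q a x = 0}. Q a x = t} = q - 1"
      using card_fibres_eqI(2)[OF finite finite, of "Q a" "UNIV - {x. Q a x = 0}" "F - {0}" "q - 1" "q - 1" t]
        cA False assms(5) q_ge_2 by fastforce
    then show ?thesis using False unfolding eq[OF False] by simp
  qed (use c0 in simp)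
qed

section \<open>The quadratic form: degenerate case\<close>

text \<open>The element \<open>1 / 2\<close> is fixed both by \<open>\<sigma>\<close> and by
  \<open>s \<mapsto> 1 - s\<close>, so the facts on twists with \<open>\<sigma> s = 1 - s\<close>
  apply to it.\<close>

lemma half:
  assumes "2 * s = 1"
  shows "(2::'a) \<noteq> 0" "1 - s = s" "\<sigma> s = 1 - s"
proof -
  show "(2::'a) \<noteq> 0" using assms by auto
  show "1 - s = s" using assms by (metis add_diff_cancel_left' mult_2)
  moreover have "2 * \<sigma> s = 2 * s" using sigma_mult[of 2 s] assms by simp
  ultimately show "\<sigma> s = 1 - s" using \<open>(2::'a) \<noteq> 0\<close>
    by (metis mult_left_cancel)
qed

lemma twist_square:
  assumes "2 * s = 1" "s * (1 - s) = nm a"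
  shows "(a * x - s * \<sigma> x)\<^sup>2 = - a * Q a x"
  using twist_mult[OF assms(2), of x] half(2)[OF assms(1)] by (simp add: power2_eq_square)

lemma card_Q_degenerate_0:
  assumes "a \<noteq> 0" "2 * s = 1" "s * (1 - s) = nm a"
  shows "card {x. Q a x = 0} = q"
proof -
  have "Q a x = 0 \<longleftrightarrow> a * x - s * \<sigma> x = 0" for x
    using twist_square[OF assms(2,3), of x] assms(1)
    by (metis mult_eq_0_iff neg_equal_0_iff_equal power_eq_0_iff pos2)
  then show ?thesis
    using card_twist(2)[OF assms(1) half(3)[OF assms(2)] assms(3), of 0] by simp
qed

text \<open>Since \<open>(L x)\<^sup>2 = - a * Q a x\<close>, one solution \<open>x\<^sub>0\<close>
  shows that the level set is the union of the fibres of \<open>L\<close> over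
  \<open>u = L x\<^sub>0\<close> and \<open>- u\<close>. These are distinct points of the line, and
  each fibre has \<open>q\<close> elements.\<close>

lemma card_Q_degenerate:
  assumes "a \<noteq> 0" "2 * s = 1" "s * (1 - s) = nm a" "t \<noteq> 0"
  shows "card {x. Q a x = t} \<in> {0, 2 * q}"
proof (cases "{x. Q a x = t} = {}")
  case False
  then obtain x\<^sub>0 where x0: "Q a x\<^sub>0 = t" by auto
  define L where "L x = a * x - s * \<sigma> x" for x
  define u where "u = L x\<^sub>0"
  note h = half[OF assms(2)]
  have sq: "(L x)\<^sup>2 = - a * Q a x" for x
    unfolding L_def by (rule twist_square[OF assms(2,3)])
  have U: "a * \<sigma> u = - (1 - s) * u"
    unfolding u_def L_def by (rule twist_image[OF h(3) assms(3)])
  then have U': "a * \<sigma> (- u) = - (1 - s) * (- u)" by simp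
  have "u \<noteq> 0" using sq[of x\<^sub>0] x0 assms by (auto simp: u_def)
  have "2 * u \<noteq> 0" using h(1) \<open>u \<noteq> 0\<close> by simp
  then have "u \<noteq> - u" by (metis add.right_inverse mult_2)
  have "Q a x = t \<longleftrightarrow> L x = u \<or> L x = - u" for x
  proof -
    have "Q a x = t \<longleftrightarrow> (L x)\<^sup>2 = u\<^sup>2"
      using assms(1) by (simp add: sq u_def x0)
    then show ?thesis by (simp add: power2_eq_iff)
  qed
  then have "{x. Q a x = t} = {x. L x = u} \<union> {x. L x = - u}" by auto
  moreover have "card {x. L x = u} = q" "card {x. L x = - u} = q"
    using card_twist(2)[OF assms(1) h(3) assms(3) U] card_twist(2)[OF assms(1) h(3) assms(3) U']
    by (simp_all add: L_def)
  moreover have "{x. L x = u} \<inter> {x. L x = - u} = {}" using \<open>u \<noteq> - u\<close> by auto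
  ultimately show ?thesis by (simp add: card_Un_disjoint)
qed simp

section \<open>Counting levels and completing the square\<close>

text \<open>The constant term of a parabola matters only through \<open>tr c\<close>, and each value
  in \<open>F\<close> is the trace of \<open>q\<close> constants. Levels \<open>t\<close> are
  therefore counted in place of constants \<open>c\<close>.\<close>

definition levels :: "'a \<Rightarrow> 'a \<Rightarrow> nat \<Rightarrow> nat" where
  "levels a b n = card {t \<in> F. card {x. Q a x - tr (b * x) = t} = n}"

lemma card_F_filter:
  assumes "m \<noteq> k"
  shows "card {t \<in> F. (if t = 0 then m else k) = n} = (if n = m then 1 else if n = k then q - 1 else 0)"
proof -
  have "{t \<in> F. (if t = 0 then m else k) = n} = (if n = m then {0} else if n = k then F - {0} else {})"
    using assms by auto
  then show ?thesis using card_F by (simp add: card_Diff_subset)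
qed

lemma levels_0_elliptic:
  assumes "a \<noteq> 0" "s \<in> F" "2 * s \<noteq> 1" "s * (1 - s) = nm a"
  shows "levels a 0 n = (if n = 1 then 1 else if n = q + 1 then q - 1 else 0)"
proof -
  have eq: "{t \<in> F. card {x. Q a x - tr (0 * x) = t} = n} = {t \<in> F. (if t = 0 then 1 else q + 1) = n}"
    using card_Q_elliptic[OF assms] by (auto simp: tr_def)
  have "1 \<noteq> q + 1" using q_ge_2 by simp
  then show ?thesis by (simp only: levels_def eq card_F_filter not_False_eq_True)
qed

lemma levels_0_hyperbolic:
  assumes "a \<noteq> 0" "\<sigma> s = 1 - s" "2 * s \<noteq> 1" "s * (1 - s) = nm a"
  shows "levels a 0 n = (if n = 2 * q - 1 then 1 else if n = q - 1 then q - 1 else 0)"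
proof -
  have eq: "{t \<in> F. card {x. Q a x - tr (0 * x) = t} = n}
      = {t \<in> F. (if t = 0 then 2 * q - 1 else q - 1) = n}"
    using card_Q_hyperbolic[OF assms] by (auto simp: tr_def)
  have "2 * q - 1 \<noteq> q - 1" using q_ge_2 by simp
  then show ?thesis by (simp only: levels_def eq card_F_filter not_False_eq_True)
qed

text \<open>Level \<open>0\<close> has \<open>q\<close> points and every other level has none or
  \<open>2 * q\<close>. Distributing all \<open>q\<^sup>2\<close> points over the levels determines
  how many of the \<open>q - 1\<close> nonzero levels are occupied.\<close>

lemma levels_0_degenerate:
  assumes "a \<noteq> 0" "2 * s = 1" "s * (1 - s) = nm a"
  shows "levels a 0 n = (if n = q then 1 else if n = 0 \<or> n = 2 * q then (q - 1) div 2 else 0)"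
proof -
  define c where "c t = card {x. Q a x = t}" for t
  define T where "T k = {t \<in> F. c t = k}" for k
  have lev: "levels a 0 n = card (T n)"
    by (simp add: levels_def T_def c_def tr_def)
  have c0: "c 0 = q" unfolding c_def by (rule card_Q_degenerate_0[OF assms])
  have c: "c t = 0 \<or> c t = 2 * q" if "t \<noteq> 0" for t
    using card_Q_degenerate[OF assms that] by (simp add: c_def)
  have "odd q" using two_eq_0_iff half(1)[OF assms(2)] by blast
  have F_eq: "F = {0} \<union> (T 0 \<union> T (2 * q))"
    using c by (auto simp: T_def)
  have "c 0 \<noteq> 0" "c 0 \<noteq> 2 * q" using c0 q_ge_2 by simp_all
  then have disj: "{0} \<inter> (T 0 \<union> T (2 * q)) = {}" "T 0 \<inter> T (2 * q) = {}"
    using q_ge_2 by (auto simp: T_def)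
  have card_F': "q = 1 + (card (T 0) + card (T (2 * q)))"
    using card_F card_Un_disjoint[OF _ _ disj(1)] card_Un_disjoint[OF _ _ disj(2)] F_eq by simp
  have "q\<^sup>2 = (\<Sum>t\<in>F. card {x \<in> UNIV. Q a x = t})"
    unfolding card_field[symmetric] by (rule card_eq_sum_fibres) auto
  also have "\<dots> = sum c F" by (simp add: c_def)
  also have "\<dots> = c 0 + (sum c (T 0) + sum c (T (2 * q)))"
    by (subst F_eq) (simp add: sum.union_disjoint disj del: Un_insert_left)
  also have "\<dots> = q + 2 * q * card (T (2 * q))"
    by (simp add: c0 T_def)
  finally have "q * q = q * (1 + 2 * card (T (2 * q)))"
    by (simp add: power2_eq_square algebra_simps)
  then have "q = 1 + 2 * card (T (2 * q))" using q_ge_2 by (simp only: mult_cancel1) simp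
  then have T: "card (T (2 * q)) = (q - 1) div 2" "card (T 0) = (q - 1) div 2"
    using card_F' by simp_all
  have "t = 0" if "t \<in> T q" for t
    using that c[of t] q_ge_2 by (auto simp: T_def)
  then have "T q = {0}" using c0 by (auto simp: T_def)
  moreover have "T n = {}" if "n \<noteq> q" "n \<noteq> 0" "n \<noteq> 2 * q"
  proof -
    have "t \<notin> T n" for t
      using that c[of t] c0 by (cases "t = 0") (auto simp: T_def)
    then show ?thesis by blast
  qed
  ultimately show ?thesis using lev T by auto
qed

text \<open>The polar form of \<open>Q a\<close> at \<open>x\<close> and \<open>x\<^sub>0\<close> is
  \<open>tr ((\<sigma> x\<^sub>0 - 2 * a * x\<^sub>0) * x)\<close>, so a centre
  \<open>x\<^sub>0\<close> for \<open>b\<close> cancels the linear term.\<close>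

lemma Q_minus_tr_shift:
  assumes "\<sigma> x\<^sub>0 - 2 * a * x\<^sub>0 = b"
  shows "Q a (x + x\<^sub>0) - tr (b * (x + x\<^sub>0)) = Q a x + (Q a x\<^sub>0 - tr (b * x\<^sub>0))"
  unfolding assms[symmetric]
  by (simp add: Q_alt tr_def algebra_simps power2_eq_square)

text \<open>Translating the abscissa by \<open>x\<^sub>0\<close> and the level by
  \<open>\<kappa>\<close>, which lies in \<open>F\<close>, matches level sets of equal size.\<close>

lemma levels_center:
  assumes "\<sigma> x\<^sub>0 - 2 * a * x\<^sub>0 = b"
  shows "levels a b n = levels a 0 n"
proof -
  define \<kappa> where "\<kappa> = Q a x\<^sub>0 - tr (b * x\<^sub>0)"
  have \<kappa>: "\<sigma> \<kappa> = \<kappa>"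
    by (simp add: \<kappa>_def)
  have Q_shift: "Q a (x + x\<^sub>0) - tr (b * (x + x\<^sub>0)) = Q a x + \<kappa>" for x
    unfolding \<kappa>_def by (rule Q_minus_tr_shift[OF assms])
  have *: "card {x. Q a x - tr (b * x) = t + \<kappa>} = card {x. Q a x = t}" for t
  proof -
    have "{x. Q a x - tr (b * x) = t + \<kappa>} = (\<lambda>x. x + x\<^sub>0) ` {x. Q a x = t}"
    proof (intro equalityI subsetI)
      fix x assume "x \<in> {x. Q a x - tr (b * x) = t + \<kappa>}"
      then have "x - x\<^sub>0 \<in> {x. Q a x = t}" using Q_shift[of "x - x\<^sub>0"] by simp
      then show "x \<in> (\<lambda>x. x + x\<^sub>0) ` {x. Q a x = t}" by (rule rev_image_eqI) simp
    qed (auto simp: Q_shift)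
    then show ?thesis by (simp add: card_image)
  qed
  have "{t \<in> F. card {x. Q a x - tr (b * x) = t} = n} = (\<lambda>t. t + \<kappa>) ` {t \<in> F. card {x. Q a x = t} = n}"
  proof (intro equalityI subsetI)
    fix t assume "t \<in> {t \<in> F. card {x. Q a x - tr (b * x) = t} = n}"
    then have "t - \<kappa> \<in> {t \<in> F. card {x. Q a x = t} = n}"
      using *[of "t - \<kappa>"] \<kappa> by (simp add: F_def)
    then show "t \<in> (\<lambda>t. t + \<kappa>) ` {t \<in> F. card {x. Q a x = t} = n}" by (rule rev_image_eqI) simp
  qed (use * \<kappa> in \<open>auto simp: F_def\<close>)
  then show ?thesis by (simp add: levels_def card_image tr_def)
qed

text \<open>Up to sign, the linear system for the centre has determinant \<open>1 - 4 * nm a = (2 * s - 1)\<^sup>2\<close>.\<close>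

lemma ex_center:
  assumes "2 * s \<noteq> 1" "s * (1 - s) = nm a"
  shows "\<exists>x\<^sub>0. \<sigma> x\<^sub>0 - 2 * a * x\<^sub>0 = b"
proof -
  define f where "f x = \<sigma> x - 2 * a * x" for x
  have f0: "x = 0" if "f x = 0" for x
  proof (rule ccontr)
    assume "x \<noteq> 0"
    have 1: "\<sigma> x = 2 * a * x" using that by (simp add: f_def)
    have "x = \<sigma> (\<sigma> x)" by simp
    also have "\<dots> = 2 * \<sigma> a * (2 * a * x)" by (subst 1) (simp add: 1)
    also have "\<dots> = 4 * nm a * x" by (simp add: nm_def)
    finally have "4 * (s * (1 - s)) = 1" using \<open>x \<noteq> 0\<close> assms(2) by simp
    moreover have "(2 * s - 1) * (2 * s - 1) = 1 - 4 * (s * (1 - s))" by (simp add: algebra_simps)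
    ultimately show False using assms(1) by simp
  qed
  have "inj f"
  proof (rule injI)
    fix x y assume "f x = f y"
    then have "f (x - y) = 0" by (simp add: f_def algebra_simps)
    then show "x = y" using f0 by force
  qed
  then have "surj f" by (simp add: finite_UNIV_inj_surj)
  then obtain x\<^sub>0 where "b = f x\<^sub>0" by (rule surjE)
  then show ?thesis by (auto simp: f_def)
qed

text \<open>With \<open>2 * s = 1\<close>, a centre for \<open>b\<close> is a preimage of
  \<open>- s * b\<close> under the twist. It exists because \<open>b\<close> lies on the line of
  values of the twist, which is stable under multiplication by \<open>- s\<close>.\<close>

lemma levels_degenerate_center:
  assumes "a \<noteq> 0" "2 * s = 1" "s * (1 - s) = nm a" "a * \<sigma> b = - (1 - s) * b"
  shows "levels a b n = levels a 0 n"
proof -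
  have "a * \<sigma> (- s * b) = - (1 - s) * (- s * b)"
  proof -
    have "a * \<sigma> (- s * b) = - \<sigma> s * (a * \<sigma> b)" by simp
    also have "\<dots> = - (1 - s) * (- (1 - s) * b)" by (simp only: half(3)[OF assms(2)] assms(4))
    also have "\<dots> = - (1 - s) * (- s * b)" by (simp only: half(2)[OF assms(2)])
    finally show ?thesis .
  qed
  then have "card {x. a * x - s * \<sigma> x = - s * b} = q"
    by (rule card_twist(2)[OF assms(1) half(3)[OF assms(2)] assms(3)])
  then have "{x. a * x - s * \<sigma> x = - s * b} \<noteq> {}"
    using q_ge_2 by (metis card.empty not_numeral_le_zero)
  then obtain x\<^sub>0 where x0: "a * x\<^sub>0 - s * \<sigma> x\<^sub>0 = - s * b" by auto
  have "\<sigma> x\<^sub>0 - 2 * a * x\<^sub>0 - b = (2 * s) * \<sigma> x\<^sub>0 - 2 * a * x\<^sub>0 - (2 * s) * b"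
    using assms(2) by simp
  also have "\<dots> = 2 * (- s * b - (a * x\<^sub>0 - s * \<sigma> x\<^sub>0))" by (simp add: algebra_simps)
  also have "\<dots> = 0" using x0 by simp
  finally have "\<sigma> x\<^sub>0 - 2 * a * x\<^sub>0 = b" by simp
  then show ?thesis by (rule levels_center)
qed

text \<open>Twist and level together determine the point, so each level set injects into the line of
  \<open>q\<close> elements. The \<open>q * q\<close> points then fill all \<open>q\<close> levels
  to this bound.\<close>

lemma levels_degenerate_off_center:
  assumes "a \<noteq> 0" "2 * s = 1" "s * (1 - s) = nm a" "a * \<sigma> b \<noteq> - (1 - s) * b"
  shows "levels a b n = (if n = q then q else 0)"
proof -
  define L where "L x = a * x - s * \<sigma> x" for x
  define U where "U = {u. a * \<sigma> u = - (1 - s) * u}"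
  define f where "f x = Q a x - tr (b * x)" for x
  note h = half[OF assms(2)]
  have det: "x = y" if "L x = L y" "f x = f y" for x y
  proof -
    have "- a * Q a x = - a * Q a y"
      using twist_square[OF assms(2,3)] that(1) unfolding L_def by metis
    then have "Q a x = Q a y" using assms(1) by simp
    then have "tr (b * (x - y)) = 0" using that(2) by (simp add: f_def tr_def algebra_simps)
    \<comment> \<open>A difference in the kernel of the twist satisfies this equation. On its
      solutions the trace becomes multiplication by \<open>2 * a * \<sigma> b + b\<close>, which is
      nonzero exactly because \<open>b\<close> is off the line.\<close>
    moreover have "\<sigma> (x - y) = 2 * a * (x - y)"
    proof -
      have "\<sigma> (x - y) - 2 * a * (x - y) = (2 * s) * \<sigma> (x - y) - 2 * a * (x - y)"
        using assms(2) by simp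
      also have "\<dots> = 2 * (L y - L x)" by (simp add: L_def algebra_simps)
      finally show ?thesis using that(1) by simp
    qed
    moreover have "tr (b * k) = (2 * a * \<sigma> b + b) * k" if "\<sigma> k = 2 * a * k" for k
      using that by (simp add: tr_def algebra_simps)
    ultimately have 1: "(2 * a * \<sigma> b + b) * (x - y) = 0" by metis
    have "2 * a * \<sigma> b + b = 2 * a * \<sigma> b + (2 * s) * b" using assms(2) by simp
    also have "\<dots> = 2 * (a * \<sigma> b + (1 - s) * b)" by (simp add: h(2) algebra_simps)
    also have "\<dots> \<noteq> 0"
    proof -
      have "a * \<sigma> b + (1 - s) * b \<noteq> 0"
        using assms(4) by (metis eq_neg_iff_add_eq_0 mult_minus_left)
      then show ?thesis using h(1) by (metis mult_eq_0_iff)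
    qed
    finally show ?thesis using 1 by simp
  qed
  have le: "card {x \<in> UNIV. f x = t} \<le> q" for t
  proof -
    have "inj_on L {x. f x = t}"
    proof (rule inj_onI)
      fix x y assume *: "x \<in> {x. f x = t}" "y \<in> {x. f x = t}" "L x = L y"
      show "x = y" by (rule det) (use * in simp_all)
    qed
    moreover have "L ` {x. f x = t} \<subseteq> U"
      unfolding L_def U_def using twist_image[OF h(3) assms(3)] by blast
    ultimately have "card {x. f x = t} \<le> card U" by (meson card_inj_on_le finite)
    then show ?thesis using card_twist(1)[OF assms(1) h(3) assms(3)] by (simp add: U_def)
  qed
  have range: "range f \<subseteq> F"
    by (auto simp: f_def F_def)
  have "card (UNIV :: 'a set) = q * q" using card_field by (simp add: power2_eq_square)
  then have "card {x \<in> UNIV. f x = t} = q" if "t \<in> F" for t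
    using card_fibres_eqI(2)[of UNIV F f q q t, OF _ _ range le] card_F q_ge_2 that by simp
  then have "{t \<in> F. card {x. f x = t} = n} = (if n = q then F else {})" by auto
  then show ?thesis unfolding levels_def f_def using card_F by simp
qed

section \<open>From levels to parabolas\<close>

lemma card_tr_vimage:
  assumes "S \<subseteq> F"
  shows "card {c. tr c \<in> S} = q * card S"
proof -
  have "card {c. tr c \<in> S} = (\<Sum>t\<in>S. card {c \<in> {c. tr c \<in> S}. tr c = t})"
    by (rule card_eq_sum_fibres) auto
  also have "\<dots> = (\<Sum>t\<in>S. q)"
  proof (rule sum.cong[OF refl])
    fix t assume "t \<in> S"
    then have "{c \<in> {c. tr c \<in> S}. tr c = t} = {c. tr c = t}" by auto
    then show "card {c \<in> {c. tr c \<in> S}. tr c = t} = q"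
      using card_tr_fibre[of t] assms \<open>t \<in> S\<close> by auto
  qed
  finally show ?thesis by simp
qed

lemma planar_intersection_eq:
  "planar_intersection (hermitian_curve q) (parabola a b c) = card {x. Q a x - tr (b * x) = tr c}"
proof -
  have "hermitian_curve q \<inter> parabola a b c
      = (\<lambda>x. (x, a * x\<^sup>2 + b * x + c)) ` {x. Q a x - tr (b * x) = tr c}"
    by (auto simp: hermitian_curve_def parabola_def Q_def nm_def tr_def frobenius[symmetric] algebra_simps)
  then show ?thesis
    unfolding planar_intersection_def by (simp add: card_image inj_on_def)
qed

lemma card_constants:
  "card {c. planar_intersection (hermitian_curve q) (parabola a b c) = n} = q * levels a b n"
  using card_tr_vimage[of "{t \<in> F. card {x. Q a x - tr (b * x) = t} = n}"]
  by (simp add: planar_intersection_eq levels_def)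

section \<open>Classification of the norms\<close>

text \<open>
  A root \<open>s\<close> of \<open>s * (1 - s) = nm a\<close> determines the type of \<open>Q a\<close>: elliptic for \<open>s \<in> ell\<close>,
  hyperbolic for \<open>s \<in> hyp\<close>, degenerate for \<open>s \<in> mid\<close>. The values \<open>0\<close> and \<open>1\<close> are
  excluded from \<open>ell\<close> because they give \<open>a = 0\<close>.
\<close>

definition ell :: "'a set" where "ell = {s \<in> F. s \<noteq> 0 \<and> s \<noteq> 1 \<and> 2 * s \<noteq> 1}"
definition hyp :: "'a set" where "hyp = {s. \<sigma> s = 1 - s \<and> 2 * s \<noteq> 1}"
definition mid :: "'a set" where "mid = {s. \<sigma> s = 1 - s \<and> 2 * s = 1}"
definition g :: "'a \<Rightarrow> 'a" where "g s = s * (1 - s)"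

lemma g_eq_iff: "g s = g r \<longleftrightarrow> r = s \<or> r = 1 - s"
proof -
  have "g s - g r = (s - r) * ((1 - s) - r)" by (simp add: g_def algebra_simps)
  then have "g s = g r \<longleftrightarrow> s - r = 0 \<or> (1 - s) - r = 0"
    by (metis mult_eq_0_iff right_minus_eq)
  then show ?thesis by auto
qed

lemma mid_eq: "mid = {s. 2 * s = 1}"
  using half(3) by (auto simp: mid_def)

lemma mid_cases: "(odd q \<and> mid = {1 / 2} \<and> (2::'a) \<noteq> 0) \<or> (even q \<and> mid = {})"
  using two_eq_0_iff by (cases "even q") (auto simp: mid_eq field_simps)

text \<open>For odd \<open>q\<close> the three distinct values \<open>0\<close>, \<open>1\<close>,
  \<open>1 / 2\<close> are removed from \<open>F\<close>; for even \<open>q\<close> only two are, as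
  \<open>2 * s = 1\<close> has no solution.\<close>

lemma card_ell: "card ell = (if odd q then q - 3 else q - 2)"
proof (cases "odd q")
  case True
  then have mid: "mid = {1 / 2}" "(2::'a) \<noteq> 0" using mid_cases by auto
  have "ell = F - {0, 1, 1 / 2}" using mid by (auto simp: ell_def mid_eq)
  moreover have "{0, 1, 1 / 2} \<subseteq> F" using mid(2) sigma_mult[of 2 "1 / 2"] by (auto simp: F_def field_simps)
  moreover have "card {0, 1, 1 / 2 :: 'a} = 3"
  proof -
    have "(2::'a) \<noteq> 1" by (metis add_cancel_left_left one_add_one zero_neq_one)
    then have "1 / 2 \<noteq> (1::'a)" using mid(2) by (simp add: divide_eq_eq)
    then show ?thesis using mid(2) by (simp add: eq_commute)
  qed
  ultimately show ?thesis using True card_F by (simp add: card_Diff_subset)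
next
  case False
  then have "ell = F - {0, 1}" using mid_cases by (auto simp: ell_def mid_eq)
  then show ?thesis using False card_F by (simp add: card_Diff_subset)
qed

text \<open>The condition \<open>\<sigma> s = 1 - s\<close> says \<open>tr s = 1\<close>, which has
  \<open>q\<close> solutions; \<open>1 / 2\<close>, if it exists, is one of them and is
  removed.\<close>

lemma card_hyp: "card hyp = (if odd q then q - 1 else q)"
proof -
  have tr: "{s. tr s = 1} = {s. \<sigma> s = 1 - s}" by (auto simp: tr_def algebra_simps)
  have "mid \<subseteq> {s. \<sigma> s = 1 - s}" by (auto simp: mid_def)
  moreover have "hyp = {s. \<sigma> s = 1 - s} - mid" by (auto simp: hyp_def mid_def)
  ultimately have "card hyp = q - card mid"
    using card_tr_fibre[of 1] tr by (simp add: card_Diff_subset)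
  then show ?thesis using mid_cases by auto
qed

text \<open>The involution \<open>s \<mapsto> 1 - s\<close> preserves \<open>A\<close> without fixed
  points there, and its orbits are the fibres of \<open>g\<close>.\<close>

lemma card_g_image:
  assumes "\<And>s. s \<in> A \<Longrightarrow> 1 - s \<in> A" "\<And>s. s \<in> A \<Longrightarrow> 2 * s \<noteq> (1::'a)"
  shows "card A = 2 * card (g ` A)"
proof (rule card_eq_mult_card_image)
  fix s assume "s \<in> A"
  have "{r \<in> A. g r = g s} = {s, 1 - s}"
    using g_eq_iff assms(1) \<open>s \<in> A\<close> by (auto simp: eq_commute[of "g _" "g s"])
  moreover have "s \<noteq> 1 - s" using assms(2)[OF \<open>s \<in> A\<close>] by (auto simp: mult_2 algebra_simps)
  ultimately show "card {r \<in> A. g r = g s} = 2" by simp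
qed simp

lemma card_g_ell: "2 * card (g ` ell) = (if odd q then q - 3 else q - 2)"
  using card_g_image[of ell] card_ell by (force simp: ell_def F_def algebra_simps)

lemma card_g_hyp: "2 * card (g ` hyp) = (if odd q then q - 1 else q)"
  using card_g_image[of hyp] card_hyp by (force simp: hyp_def algebra_simps)

lemma card_g_mid: "card (g ` mid) = (if odd q then 1 else 0)"
  using mid_cases by auto

text \<open>Equal values of \<open>g\<close> come only from \<open>s\<close> and
  \<open>1 - s\<close>. Membership in \<open>F\<close> and the condition \<open>2 * s = 1\<close>
  are invariant under this exchange, and \<open>\<sigma> s = s = 1 - s\<close> would give
  \<open>2 * s = 1\<close>.\<close>

lemma g_disjoint: "g ` ell \<inter> g ` hyp = {}" "(g ` ell \<union> g ` hyp) \<inter> g ` mid = {}"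
proof -
  have "1 - s = s \<longleftrightarrow> 2 * s = 1" for s :: 'a by (auto simp: mult_2 algebra_simps)
  then show "g ` ell \<inter> g ` hyp = {}"
    by (auto simp: g_eq_iff ell_def hyp_def F_def)
  show "(g ` ell \<union> g ` hyp) \<inter> g ` mid = {}"
  proof -
    have "2 * (1 - s) - 1 = 1 - 2 * s" for s :: 'a by (simp add: algebra_simps)
    then have "2 * (1 - s) = 1 \<longleftrightarrow> 2 * s = 1" for s :: 'a by (metis right_minus_eq)
    then have "g s \<noteq> g r" if "2 * s \<noteq> 1" "2 * r = 1" for s r
      using that by (auto simp: g_eq_iff)
    then show ?thesis by (force simp: ell_def hyp_def mid_eq)
  qed
qed

text \<open>For \<open>\<sigma> s = 1 - s\<close> the value \<open>g s\<close> is the norm of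
  \<open>s\<close>, which explains why it lies in \<open>F\<close> although \<open>s\<close> need
  not.\<close>

lemma g_subset: "g ` ell \<subseteq> F - {0}" "g ` hyp \<subseteq> F - {0}" "g ` mid \<subseteq> F - {0}"
proof -
  show "g ` ell \<subseteq> F - {0}" by (auto simp: ell_def g_def F_def)
  have *: "g s \<in> F - {0}" if "\<sigma> s = 1 - s" for s
  proof -
    have "g s = nm s" using that by (simp add: g_def nm_def)
    moreover have "s \<noteq> 0" using that by auto
    ultimately show ?thesis by simp
  qed
  then show "g ` hyp \<subseteq> F - {0}" by (auto simp: hyp_def)
  show "g ` mid \<subseteq> F - {0}" using * by (auto simp: mid_def)
qed

text \<open>Solvability of \<open>s * (1 - s) = n\<close> for every nonzero \<open>n\<close> in
  \<open>F\<close> comes from counting: the three images are disjoint and their sizes add up to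
  \<open>q - 1\<close>.\<close>

lemma g_cover: "F - {0} = g ` ell \<union> g ` hyp \<union> g ` mid"
proof (rule sym, rule card_subset_eq)
  have "card (g ` ell \<union> g ` hyp \<union> g ` mid) = card (g ` ell) + card (g ` hyp) + card (g ` mid)"
    using g_disjoint by (simp add: card_Un_disjoint)
  also have "\<dots> = q - 1"
    using card_g_ell card_g_hyp card_g_mid q_ge_2 by (cases "odd q") (auto elim!: oddE)
  finally show "card (g ` ell \<union> g ` hyp \<union> g ` mid) = card (F - {0})"
    using card_F by (simp add: card_Diff_subset)
qed (use g_subset in auto)

section \<open>Level counts for each type of norm\<close>

lemma levels_ell:
  assumes "nm a \<in> g ` ell"
  shows "levels a b n = (if n = 1 then 1 else if n = q + 1 then q - 1 else 0)"
proof -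
  from assms obtain s where s: "s \<in> F" "2 * s \<noteq> 1" "s * (1 - s) = nm a"
    by (auto simp: ell_def g_def)
  have "nm a \<in> F - {0}" using assms g_subset(1) by blast
  then have "a \<noteq> 0" by auto
  obtain x\<^sub>0 where "\<sigma> x\<^sub>0 - 2 * a * x\<^sub>0 = b" using ex_center[OF s(2,3)] by blast
  then show ?thesis
    using levels_center levels_0_elliptic[OF \<open>a \<noteq> 0\<close> s] by simp
qed

lemma levels_hyp:
  assumes "nm a \<in> g ` hyp"
  shows "levels a b n = (if n = 2 * q - 1 then 1 else if n = q - 1 then q - 1 else 0)"
proof -
  from assms obtain s where s: "\<sigma> s = 1 - s" "2 * s \<noteq> 1" "s * (1 - s) = nm a"
    by (auto simp: hyp_def g_def)
  have "nm a \<in> F - {0}" using assms g_subset(2) by blast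
  then have "a \<noteq> 0" by auto
  obtain x\<^sub>0 where "\<sigma> x\<^sub>0 - 2 * a * x\<^sub>0 = b" using ex_center[OF s(2,3)] by blast
  then show ?thesis
    using levels_center levels_0_hyperbolic[OF \<open>a \<noteq> 0\<close> s] by simp
qed

text \<open>Here the answer depends on \<open>b\<close>. The set \<open>U\<close> is the line of
  values of the twist: on it a centre exists, off it all levels have \<open>q\<close>
  points.\<close>

lemma levels_mid:
  assumes "nm a \<in> g ` mid"
  obtains U where "card U = q"
    and "\<And>b n. b \<in> U \<Longrightarrow>
      levels a b n = (if n = q then 1 else if n = 0 \<or> n = 2 * q then (q - 1) div 2 else 0)"
    and "\<And>b n. b \<notin> U \<Longrightarrow> levels a b n = (if n = q then q else 0)"
proof -
  from assms obtain s where s: "2 * s = 1" "s * (1 - s) = nm a"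
    by (auto simp: mid_def g_def)
  have "nm a \<in> F - {0}" using assms g_subset(3) by blast
  then have "a \<noteq> 0" by auto
  show thesis
  proof (rule that[of "{u. a * \<sigma> u = - (1 - s) * u}"])
    show "card {u. a * \<sigma> u = - (1 - s) * u} = q"
      by (rule card_twist(1)[OF \<open>a \<noteq> 0\<close> half(3)[OF s(1)] s(2)])
  qed (use levels_degenerate_center[OF \<open>a \<noteq> 0\<close> s] levels_0_degenerate[OF \<open>a \<noteq> 0\<close> s]
      levels_degenerate_off_center[OF \<open>a \<noteq> 0\<close> s] in auto)
qed

lemma sum_levels_mid:
  assumes "nm a \<in> g ` mid"
  shows "(\<Sum>b\<in>UNIV. levels a b n)
    = q * (if n = q then 1 else if n = 0 \<or> n = 2 * q then (q - 1) div 2 else 0)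
      + (q\<^sup>2 - q) * (if n = q then q else 0)"
proof -
  obtain U where U: "card U = q"
    "\<And>b n. b \<in> U \<Longrightarrow>
      levels a b n = (if n = q then 1 else if n = 0 \<or> n = 2 * q then (q - 1) div 2 else 0)"
    "\<And>b n. b \<notin> U \<Longrightarrow> levels a b n = (if n = q then q else 0)"
    using levels_mid[OF assms] by blast
  have "(\<Sum>b\<in>UNIV. levels a b n) = (\<Sum>b\<in>U. levels a b n) + (\<Sum>b\<in>UNIV - U. levels a b n)"
    by (simp add: sum.subset_diff[of U UNIV] add.commute)
  also have "(\<Sum>b\<in>U. levels a b n)
      = (\<Sum>b\<in>U. if n = q then 1 else if n = 0 \<or> n = 2 * q then (q - 1) div 2 else 0)"
    by (rule sum.cong) (simp_all add: U(2))
  also have "(\<Sum>b\<in>UNIV - U. levels a b n) = (\<Sum>b\<in>UNIV - U. if n = q then q else 0)"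
    by (rule sum.cong) (simp_all add: U(3))
  finally show ?thesis
    using U(1) card_field by (simp add: card_Diff_subset)
qed

lemma nm_cases:
  assumes "a \<noteq> 0"
  obtains "nm a \<in> g ` ell" | "nm a \<in> g ` hyp" | "nm a \<in> g ` mid"
  using assms g_cover nm_in_F[of a] by (metis DiffI Un_iff nm_eq_0_iff singletonD)

section \<open>Possible intersections and the number of parabolas\<close>

lemma planar_intersection_cases:
  fixes a b c :: 'a
  assumes "a \<noteq> 0"
  shows "planar_intersection (hermitian_curve q) (parabola a b c) \<in>
    (if odd q then {0, 1, q - 1, q, q + 1, 2 * q - 1, 2 * q} else {1, q - 1, q + 1, 2 * q - 1})" (is "_ \<in> ?S")
proof -
  define n where "n = planar_intersection (hermitian_curve q) (parabola a b c)"
  \<comment> \<open>The constant \<open>c\<close> itself attains the size \<open>n\<close>, so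
    \<open>n\<close> must be one of the sizes with a nonzero level count.\<close>
  have lev: "levels a b n \<noteq> 0"
  proof
    assume "levels a b n = 0"
    then have "{c. planar_intersection (hermitian_curve q) (parabola a b c) = n} = {}"
      using card_constants[of a b n] by (simp only: mult_0_right card_0_eq finite)
    then show False unfolding n_def by blast
  qed
  from assms have "n \<in> ?S"
  proof (cases rule: nm_cases)
    case 1
    then show ?thesis using lev levels_ell[OF 1, of b n] by (auto split: if_splits)
  next
    case 2
    then show ?thesis using lev levels_hyp[OF 2, of b n] by (auto split: if_splits)
  next
    case 3
    then have "odd q" using mid_cases by auto
    moreover obtain U where "card U = q" "\<And>b n. b \<in> U \<Longrightarrow>
        levels a b n = (if n = q then 1 else if n = 0 \<or> n = 2 * q then (q - 1) div 2 else 0)"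
      "\<And>b n. b \<notin> U \<Longrightarrow> levels a b n = (if n = q then q else 0)"
      using levels_mid[OF 3] by blast
    ultimately show ?thesis using lev by (cases "b \<in> U") (auto split: if_splits)
  qed
  then show ?thesis by (simp only: n_def)
qed

text \<open>Each nonzero norm belongs to \<open>q + 1\<close> leading coefficients, and each level
  to \<open>q\<close> constants. The elliptic and hyperbolic counts are the same for all
  \<open>q\<^sup>2\<close> linear coefficients, whereas the degenerate term splits these into
  \<open>q\<close> on the line and \<open>q\<^sup>2 - q\<close> off it. The terms are added, so
  coinciding sizes are handled correctly.\<close>

lemma num_parabolas_eq:
  "num_parabolas TYPE('a) q n =
    (q + 1) * card (g ` ell) * (q ^ 3 * (if n = 1 then 1 else if n = q + 1 then q - 1 else 0)) +
    (q + 1) * card (g ` hyp) * (q ^ 3 * (if n = 2 * q - 1 then 1 else if n = q - 1 then q - 1 else 0)) +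
    (q + 1) * card (g ` mid) *
      (q\<^sup>2 * (if n = q then 1 else if n = 0 \<or> n = 2 * q then (q - 1) div 2 else 0)
       + q * (q\<^sup>2 - q) * (if n = q then q else 0))"
proof -
  define A where "A S = {a. nm a \<in> g ` S}" for S
  define e where "e = (if n = 1 then 1 else if n = q + 1 then q - 1 else 0)"
  define h where "h = (if n = 2 * q - 1 then 1 else if n = q - 1 then q - 1 else 0)"
  define d where "d = (if n = q then 1 else if n = 0 \<or> n = 2 * q then (q - 1) div 2 else 0)"
  define d' where "d' = (if n = q then q else 0)"
  have UNIV: "UNIV - {0} = A ell \<union> A hyp \<union> A mid"
  proof -
    have "UNIV - {0} = {a. nm a \<in> F - {0}}" by auto
    then show ?thesis unfolding g_cover by (auto simp: A_def)
  qed
  have disj: "A ell \<inter> A hyp = {}" "(A ell \<union> A hyp) \<inter> A mid = {}"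
    using g_disjoint by (auto simp: A_def)
  have cA: "card (A ell) = (q + 1) * card (g ` ell)" "card (A hyp) = (q + 1) * card (g ` hyp)"
    "card (A mid) = (q + 1) * card (g ` mid)"
    unfolding A_def using card_nm_vimage g_subset by blast+
  have "{(a::'a, b, c). a \<noteq> 0 \<and> planar_intersection (hermitian_curve q) (parabola a b c) = n}
      = (SIGMA a:UNIV - {0}. SIGMA b:UNIV. {c. planar_intersection (hermitian_curve q) (parabola a b c) = n})"
    by auto
  then have "num_parabolas TYPE('a) q n = (\<Sum>a\<in>UNIV - {0}. \<Sum>b\<in>UNIV. q * levels a b n)"
    unfolding num_parabolas_def by (simp add: card_constants)
  also have "\<dots> = (\<Sum>a\<in>A ell. \<Sum>b\<in>UNIV. q * levels a b n)
      + (\<Sum>a\<in>A hyp. \<Sum>b\<in>UNIV. q * levels a b n) + (\<Sum>a\<in>A mid. q * (\<Sum>b\<in>UNIV. levels a b n))"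
    unfolding UNIV by (simp add: sum.union_disjoint disj sum_distrib_left)
  also have "(\<Sum>a\<in>A ell. \<Sum>b\<in>UNIV. q * levels a b n) = (\<Sum>a\<in>A ell. \<Sum>b\<in>(UNIV :: 'a set). q * e)"
    unfolding e_def by (intro sum.cong refl arg_cong[where f = "(*) q"] levels_ell) (simp add: A_def)
  also have "(\<Sum>a\<in>A hyp. \<Sum>b\<in>UNIV. q * levels a b n) = (\<Sum>a\<in>A hyp. \<Sum>b\<in>(UNIV :: 'a set). q * h)"
    unfolding h_def by (intro sum.cong refl arg_cong[where f = "(*) q"] levels_hyp) (simp add: A_def)
  also have "(\<Sum>a\<in>A mid. q * (\<Sum>b\<in>UNIV. levels a b n)) = (\<Sum>a\<in>A mid. q * (q * d + (q\<^sup>2 - q) * d'))"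
    unfolding d_def d'_def
    by (intro sum.cong refl arg_cong[where f = "(*) q"] sum_levels_mid) (simp add: A_def)
  finally have "num_parabolas TYPE('a) q n = (q + 1) * card (g ` ell) * (q\<^sup>2 * (q * e))
      + (q + 1) * card (g ` hyp) * (q\<^sup>2 * (q * h))
      + (q + 1) * card (g ` mid) * (q * (q * d + (q\<^sup>2 - q) * d'))"
    by (simp only: sum_constant cA card_field of_nat_id)
  moreover have "q\<^sup>2 * (q * x) = q ^ 3 * x" "q * (q * x + (q\<^sup>2 - q) * y) = q\<^sup>2 * x + q * (q\<^sup>2 - q) * y" for x y
    by (simp_all add: power2_eq_square power3_eq_cube distrib_left)
  ultimately show ?thesis
    unfolding e_def[symmetric] h_def[symmetric] d_def[symmetric] d'_def[symmetric] by metis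
qed

end

section \<open>Evaluation for odd and even \<open>q\<close>\<close>

lemma num_parabolas_odd:
  fixes q :: nat
  assumes "quadratic_extension q (\<lambda>x::'a::finite_field. x ^ q)" "odd q"
  shows
    "real (num_parabolas TYPE('a) q 0) = real q ^ 2 * (real q + 1) * ((real q - 1) / 2)"
    "real (num_parabolas TYPE('a) q 1) = real q ^ 2 * (real q + 1) * (real q * (real q - 3) / 2)"
    "real (num_parabolas TYPE('a) q (q - 1))
      = real q ^ 2 * (real q + 1) * (real q * (real q - 1) ^ 2 / 2)"
    "real (num_parabolas TYPE('a) q q)
      = real q ^ 2 * (real q + 1) * (real q ^ 2 - real q + 1)"
    "real (num_parabolas TYPE('a) q (q + 1))
      = real q ^ 2 * (real q + 1) * (real q * (real q - 1) * (real q - 3) / 2)"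
    "real (num_parabolas TYPE('a) q (2 * q - 1))
      = real q ^ 2 * (real q + 1) * (real q * (real q - 1) / 2)"
    "real (num_parabolas TYPE('a) q (2 * q)) = real q ^ 2 * (real q + 1) * ((real q - 1) / 2)"
proof -
  interpret quadratic_extension q "\<lambda>x::'a. x ^ q" by fact
  obtain k where "q = 2 * k + 1" using \<open>odd q\<close> by (rule oddE)
  \<comment> \<open>An odd \<open>q \<ge> 2\<close> is at least \<open>3\<close>. In terms of
    \<open>m\<close> the truncated subtractions and the halves become polynomials.\<close>
  then have "q = 2 * (k - 1) + 3" using q_ge_2 by simp
  then obtain m where q: "q = 2 * m + 3" by blast
  have cards: "card (g ` ell) = m" "card (g ` hyp) = m + 1" "card (g ` mid) = 1"
    using card_g_ell card_g_hyp card_g_mid q by simp_all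
  note num = num_parabolas_eq[unfolded cards]
  have sub: "q\<^sup>2 - q = (2 * m + 3) * (2 * m + 2)" "q - 1 = 2 * m + 2" "(2 * m + 2) div 2 = m + 1"
    "2 * q - 1 = 4 * m + 5"
    using q by (simp_all add: power2_eq_square algebra_simps)
  show "real (num_parabolas TYPE('a) q 0) = real q ^ 2 * (real q + 1) * ((real q - 1) / 2)"
    unfolding num sub by (simp add: q power2_eq_square power3_eq_cube field_simps)
  show "real (num_parabolas TYPE('a) q 1) = real q ^ 2 * (real q + 1) * (real q * (real q - 3) / 2)"
    unfolding num sub by (simp add: q power2_eq_square power3_eq_cube field_simps)
  show "real (num_parabolas TYPE('a) q (q - 1))
      = real q ^ 2 * (real q + 1) * (real q * (real q - 1) ^ 2 / 2)"
    unfolding num sub by (simp add: q power2_eq_square power3_eq_cube field_simps)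
  show "real (num_parabolas TYPE('a) q q)
      = real q ^ 2 * (real q + 1) * (real q ^ 2 - real q + 1)"
    unfolding num sub by (simp add: q power2_eq_square power3_eq_cube field_simps)
  show "real (num_parabolas TYPE('a) q (q + 1))
      = real q ^ 2 * (real q + 1) * (real q * (real q - 1) * (real q - 3) / 2)"
    unfolding num sub by (simp add: q power2_eq_square power3_eq_cube field_simps)
  show "real (num_parabolas TYPE('a) q (2 * q - 1))
      = real q ^ 2 * (real q + 1) * (real q * (real q - 1) / 2)"
    unfolding num sub by (simp add: q power2_eq_square power3_eq_cube field_simps)
  show "real (num_parabolas TYPE('a) q (2 * q)) = real q ^ 2 * (real q + 1) * ((real q - 1) / 2)"
    unfolding num sub by (simp add: q power2_eq_square power3_eq_cube field_simps)
qed

text \<open>A sum of conditional terms replaces a case distinction, because for \<open>q = 2\<close>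
  the sizes \<open>1\<close> and \<open>q - 1\<close> coincide, as do \<open>q + 1\<close> and
  \<open>2 * q - 1\<close>, and their counts add.\<close>

lemma num_parabolas_even:
  fixes q :: nat
  assumes "quadratic_extension q (\<lambda>x::'a::finite_field. x ^ q)" "even q"
  shows "real (num_parabolas TYPE('a) q n) =
    (if n = 1 then real q ^ 3 * (real q + 1) * (real q / 2 - 1) else 0) +
    (if n = q - 1 then real q ^ 3 * (real q + 1) * (real q - 1) * (real q / 2) else 0) +
    (if n = q + 1 then real q ^ 3 * (real q + 1) * (real q - 1) * (real q / 2 - 1) else 0) +
    (if n = 2 * q - 1 then real q ^ 3 * (real q + 1) * (real q / 2) else 0)"
proof -
  interpret quadratic_extension q "\<lambda>x::'a. x ^ q" by fact
  obtain m where q: "q = 2 * m + 2"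
  proof -
    obtain k where "q = 2 * k" using \<open>even q\<close> by (rule evenE)
    then have "q = 2 * (k - 1) + 2" using q_ge_2 by simp
    then show thesis by (rule that)
  qed
  have cards: "card (g ` ell) = m" "card (g ` hyp) = m + 1" "card (g ` mid) = 0"
    using card_g_ell card_g_hyp card_g_mid q by simp_all
  have sub: "q - 1 = 2 * m + 1" "2 * q - 1 = 4 * m + 3"
    using q by simp_all
  show ?thesis
    unfolding num_parabolas_eq[of n, unfolded cards] sub
    by (simp add: q power2_eq_square power3_eq_cube field_simps)
qed

theorem theorem3p1:
  fixes q :: nat
  assumes "primepow q" and "CARD('a::finite_field) = q ^ 2"
  shows
    "(odd q \<longrightarrow>
       (\<forall>a b c :: 'a. a \<noteq> 0 \<longrightarrow>
          planar_intersection (hermitian_curve q) (parabola a b c)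
            \<in> {0, 1, q - 1, q, q + 1, 2 * q - 1, 2 * q}) \<and>
       real (num_parabolas TYPE('a) q 0)
         = real q ^ 2 * (real q + 1) * ((real q - 1) / 2) \<and>
       real (num_parabolas TYPE('a) q 1)
         = real q ^ 2 * (real q + 1) * (real q * (real q - 3) / 2) \<and>
       real (num_parabolas TYPE('a) q (q - 1))
         = real q ^ 2 * (real q + 1) * (real q * (real q - 1) ^ 2 / 2) \<and>
       real (num_parabolas TYPE('a) q q)
         = real q ^ 2 * (real q + 1) * (real q ^ 2 - real q + 1) \<and>
       real (num_parabolas TYPE('a) q (q + 1))
         = real q ^ 2 * (real q + 1) * (real q * (real q - 1) * (real q - 3) / 2) \<and>
       real (num_parabolas TYPE('a) q (2 * q - 1))
         = real q ^ 2 * (real q + 1) * (real q * (real q - 1) / 2) \<and>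
       real (num_parabolas TYPE('a) q (2 * q))
         = real q ^ 2 * (real q + 1) * ((real q - 1) / 2)) \<and>
     (even q \<longrightarrow>
       (\<forall>a b c :: 'a. a \<noteq> 0 \<longrightarrow>
          planar_intersection (hermitian_curve q) (parabola a b c)
            \<in> {1, q - 1, q + 1, 2 * q - 1}) \<and>
       (q \<noteq> 2 \<longrightarrow>
          real (num_parabolas TYPE('a) q 1)
            = real q ^ 3 * (real q + 1) * (real q / 2 - 1) \<and>
          real (num_parabolas TYPE('a) q (q - 1))
            = real q ^ 3 * (real q + 1) * (real q - 1) * (real q / 2) \<and>
          real (num_parabolas TYPE('a) q (q + 1))
            = real q ^ 3 * (real q + 1) * (real q - 1) * (real q / 2 - 1) \<and>
          real (num_parabolas TYPE('a) q (2 * q - 1))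
            = real q ^ 3 * (real q + 1) * (real q / 2)) \<and>
       \<comment> \<open>For q = 2 the values 1 and q - 1 coincide, as do q + 1 and 2 * q - 1:
           the listed counts for coinciding values are added.\<close>
       (q = 2 \<longrightarrow>
          real (num_parabolas TYPE('a) q 1)
            = real q ^ 3 * (real q + 1) * (real q / 2 - 1)
              + real q ^ 3 * (real q + 1) * (real q - 1) * (real q / 2) \<and>
          real (num_parabolas TYPE('a) q (q + 1))
            = real q ^ 3 * (real q + 1) * (real q - 1) * (real q / 2 - 1)
              + real q ^ 3 * (real q + 1) * (real q / 2)))"
proof -
  have ext: "quadratic_extension q (\<lambda>x::'a. x ^ q)"
    by standard (use assms in simp_all)
  note cases = quadratic_extension.planar_intersection_cases[OF ext]
  have even_large: "real (num_parabolas TYPE('a) q 1) = real q ^ 3 * (real q + 1) * (real q / 2 - 1)"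
    "real (num_parabolas TYPE('a) q (q - 1)) = real q ^ 3 * (real q + 1) * (real q - 1) * (real q / 2)"
    "real (num_parabolas TYPE('a) q (q + 1))
      = real q ^ 3 * (real q + 1) * (real q - 1) * (real q / 2 - 1)"
    "real (num_parabolas TYPE('a) q (2 * q - 1)) = real q ^ 3 * (real q + 1) * (real q / 2)"
    if "even q" "q \<noteq> 2"
  proof -
    \<comment> \<open>Writing \<open>q = k + 3\<close> makes it evident that the four sizes are
      distinct, so that a single term survives each time.\<close>
    have "q = (q - 3) + 3" using that quadratic_extension.q_ge_2[OF ext] by simp
    then obtain k where q: "q = k + 3" by blast
    show "real (num_parabolas TYPE('a) q 1) = real q ^ 3 * (real q + 1) * (real q / 2 - 1)"
      by (subst num_parabolas_even[OF ext \<open>even q\<close>]) (simp add: q)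
    show "real (num_parabolas TYPE('a) q (q - 1))
        = real q ^ 3 * (real q + 1) * (real q - 1) * (real q / 2)"
      by (subst num_parabolas_even[OF ext \<open>even q\<close>]) (simp add: q)
    show "real (num_parabolas TYPE('a) q (q + 1))
        = real q ^ 3 * (real q + 1) * (real q - 1) * (real q / 2 - 1)"
      by (subst num_parabolas_even[OF ext \<open>even q\<close>]) (simp add: q)
    show "real (num_parabolas TYPE('a) q (2 * q - 1)) = real q ^ 3 * (real q + 1) * (real q / 2)"
      by (subst num_parabolas_even[OF ext \<open>even q\<close>]) (simp add: q)
  qed
  have even_2: "real (num_parabolas TYPE('a) q 1)
      = real q ^ 3 * (real q + 1) * (real q / 2 - 1)
        + real q ^ 3 * (real q + 1) * (real q - 1) * (real q / 2)"
    "real (num_parabolas TYPE('a) q (q + 1))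
      = real q ^ 3 * (real q + 1) * (real q - 1) * (real q / 2 - 1)
        + real q ^ 3 * (real q + 1) * (real q / 2)" if "q = 2"
  proof -
    have "even q" using that by simp
    then show "real (num_parabolas TYPE('a) q 1)
      = real q ^ 3 * (real q + 1) * (real q / 2 - 1)
        + real q ^ 3 * (real q + 1) * (real q - 1) * (real q / 2)"
      "real (num_parabolas TYPE('a) q (q + 1))
      = real q ^ 3 * (real q + 1) * (real q - 1) * (real q / 2 - 1)
        + real q ^ 3 * (real q + 1) * (real q / 2)"
      by (subst num_parabolas_even[OF ext], simp, simp add: that)+
  qed
  have odd_range: "planar_intersection (hermitian_curve q) (parabola a b c)
      \<in> {0, 1, q - 1, q, q + 1, 2 * q - 1, 2 * q}" if "odd q" "a \<noteq> 0" for a b c :: 'a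
    using cases[OF that(2), of b c] that(1) by (simp only: if_True not_False_eq_True)
  have even_range: "planar_intersection (hermitian_curve q) (parabola a b c)
      \<in> {1, q - 1, q + 1, 2 * q - 1}" if "even q" "a \<noteq> 0" for a b c :: 'a
    using cases[OF that(2), of b c] that(1) by (simp only: if_False not_True_eq_False)
  show ?thesis
    by (intro conjI impI allI)
      (rule odd_range even_range num_parabolas_odd[OF ext] even_large even_2; assumption)+
qed

end
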